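(* For every integer $r\ge1$, $$p_r=\int_0^\infty r e^{-rt}\prod_{\substack{k\ge1\\ k\ne r}}\bigl(1-e^{-kt}\bigr)\,dt=\int_0^1 r\,u^{r-1}\prod_{\substack{k\ge1\\ k\ne r}}(1-u^k)\,du=\int_0^1 r\,u^{r-1}\frac{\Phi(u)}{1-u^r}\,du .$$
   Context: Let $(Y_r)_{r\ge1}$ be a sequence of independent random variables such that $Y_r$ has the exponential distribution with rate $r$ (density $re^{-rt}$, $t>0$) for every $r\ge1$. For $r\ge1$ define $p_r:=\mathbb P\left(Y_r=\max_{k\ge1}Y_k\right)$, the event being that $Y_k\le Y_r$ for all $k\ge1$. Euler's product is $\Phi(u):=\prod_{k=1}^\infty(1-u^k)$ for $0<u<1$. *)

theory Defs
  imports "HOL-Probability.Probability"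
begin

text \<open>
  Infinite products over the positive integers are expressed by the library's products over
  \<^typ>\<open>nat\<close>, whose first index is 0, with the factor of index \<open>k\<close> at position \<open>k - 1\<close>.
  Leaving out the index \<open>k = r\<close> means replacing its factor by 1.
\<close>

definition omit :: "nat \<Rightarrow> (nat \<Rightarrow> real) \<Rightarrow> nat \<Rightarrow> real" where
  "omit r f n = (if Suc n = r then 1 else f (Suc n))"

text \<open>Only the values on the open unit interval are meaningful.\<close>

definition euler_product :: "real \<Rightarrow> real" where
  "euler_product u = (\<Prod>n. 1 - u ^ Suc n)"

definition (in prob_space) prob_is_max :: "(nat \<Rightarrow> 'a \<Rightarrow> real) \<Rightarrow> nat \<Rightarrow> real" where
  "prob_is_max Y r = prob {\<omega> \<in> space M. \<forall>k\<ge>1. Y k \<omega> \<le> Y r \<omega>}"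

end

theory Submission
  imports Defs
begin

text \<open>
  Conditioning on \<open>Y r = t\<close> turns the event into the independent events \<open>Y k \<le> t\<close> with
  \<open>k \<noteq> r\<close>; continuity from above turns the finite products into the infinite one, so the joint
  law can be used for all \<open>k\<close> at once and no limit has to be exchanged with the integral.
\<close>

section \<open>Conditioning on one variable of a countable independent family\<close>

lemma (in prob_space) borel_measurable_emeasure_all_le:
  fixes X :: "'i \<Rightarrow> 'a \<Rightarrow> real"
  assumes X[measurable]: "\<And>k. k \<in> J \<Longrightarrow> X k \<in> borel_measurable M" and J: "countable J"
  shows "(\<lambda>t. emeasure M {\<omega> \<in> space M. \<forall>k\<in>J. X k \<omega> \<le> t}) \<in> borel_measurable borel"
proof -
  have "{\<omega> \<in> space M. \<forall>k\<in>J. X k \<omega> \<le> t} \<in> events" for t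
    by (rule sets.sets_Collect_countable_All'[OF _ J]) measurable
  \<comment> \<open>Raising \<open>t\<close> enlarges the event, and monotone real functions are
    Borel; no knowledge of the joint law enters.\<close>
  then have "mono (\<lambda>t. prob {\<omega> \<in> space M. \<forall>k\<in>J. X k \<omega> \<le> t})"
    by (intro monoI finite_measure_mono) force+
  then have [measurable]: "(\<lambda>t. prob {\<omega> \<in> space M. \<forall>k\<in>J. X k \<omega> \<le> t}) \<in> borel_measurable borel"
    by (rule borel_measurable_mono)
  show ?thesis
    unfolding emeasure_eq_measure by measurable
qed

text \<open>Independence makes the joint law of \<open>X r\<close> and the family of the other
  variables a product measure, so the measure of the event is the integral of the measures of its
  sections. The section at \<open>X r = t\<close> is the event that all other variables are at most
  \<open>t\<close>. Countability of \<open>I\<close> keeps the events measurable.\<close>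

lemma (in prob_space) emeasure_all_le_indep:
  fixes X :: "'i \<Rightarrow> 'a \<Rightarrow> real"
  assumes indep: "indep_vars (\<lambda>_. borel) X I" and I: "countable I" and r: "r \<in> I"
  shows "emeasure M {\<omega> \<in> space M. \<forall>k\<in>I. X k \<omega> \<le> X r \<omega>} =
    (\<integral>\<^sup>+t. emeasure M {\<omega> \<in> space M. \<forall>k\<in>I - {r}. X k \<omega> \<le> t} \<partial>distr M borel (X r))"
proof -
  define J where "J = I - {r}"
  define F where "F = (\<lambda>t. emeasure M {\<omega> \<in> space M. \<forall>k\<in>J. X k \<omega> \<le> t})"
  define P where "P = (\<lambda>J::'i set. PiM J (\<lambda>_. borel :: real measure))"
  \<comment> \<open>Splitting an independent family along disjoint index sets yields restricted
    families, so \<open>X r\<close> first appears as a function on the one-point set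
    \<open>{r}\<close>.\<close>
  define W where "W = (\<lambda>\<omega>. restrict (\<lambda>i. X i \<omega>) {r})"
  define Z where "Z = (\<lambda>\<omega>. restrict (\<lambda>i. X i \<omega>) J)"
  define E where "E = {p \<in> space (P {r} \<Otimes>\<^sub>M P J). \<forall>k\<in>J. snd p k \<le> fst p r}"
  have rv: "X k \<in> borel_measurable M" if "k \<in> I" for k
    using indep that by (simp add: indep_vars_def)
  have J: "countable J" using I by (simp add: J_def)
  have [measurable]: "F \<in> borel_measurable borel"
    unfolding F_def by (rule borel_measurable_emeasure_all_le[OF rv J]) (simp add: J_def)
  have [measurable]: "X r \<in> borel_measurable M" using r by (rule rv)
  have ind: "indep_var (P {r}) W (P J) Z"
    unfolding P_def W_def Z_def using r by (intro indep_var_restrict[OF indep]) (auto simp: J_def)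
  have [measurable]: "W \<in> measurable M (P {r})" "Z \<in> measurable M (P J)"
    and joint: "distr M (P {r}) W \<Otimes>\<^sub>M distr M (P J) Z =
      distr M (P {r} \<Otimes>\<^sub>M P J) (\<lambda>\<omega>. (W \<omega>, Z \<omega>))"
    using ind unfolding indep_var_distribution_eq by auto
  have "{p \<in> space (P {r} \<Otimes>\<^sub>M P J). snd p k \<le> fst p r} \<in> sets (P {r} \<Otimes>\<^sub>M P J)" if "k \<in> J" for k
  proof -
    have [measurable]: "(\<lambda>p. snd p k) \<in> borel_measurable (P {r} \<Otimes>\<^sub>M P J)"
      "(\<lambda>p. fst p r) \<in> borel_measurable (P {r} \<Otimes>\<^sub>M P J)"
      using that unfolding P_def
      by (auto intro: measurable_compose[OF measurable_snd measurable_component_singleton]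
          measurable_compose[OF measurable_fst measurable_component_singleton])
    show ?thesis by measurable
  qed
  then have E[measurable]: "E \<in> sets (P {r} \<Otimes>\<^sub>M P J)"
    unfolding E_def using J by (rule sets.sets_Collect_countable_All')
  interpret Z: prob_space "distr M (P J) Z" by (rule prob_space_distr) simp
  have [simp]: "W \<omega> \<in> space (P {r})" "Z \<omega> \<in> space (P J)" if "\<omega> \<in> space M" for \<omega>
    using that measurable_space[OF \<open>W \<in> measurable M (P {r})\<close>]
      measurable_space[OF \<open>Z \<in> measurable M (P J)\<close>] by auto
  have "{\<omega> \<in> space M. \<forall>k\<in>I. X k \<omega> \<le> X r \<omega>} = (\<lambda>\<omega>. (W \<omega>, Z \<omega>)) -` E \<inter> space M"
    by (auto simp: E_def space_pair_measure) (auto simp: W_def Z_def J_def)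
  then have "emeasure M {\<omega> \<in> space M. \<forall>k\<in>I. X k \<omega> \<le> X r \<omega>} =
      emeasure (distr M (P {r}) W \<Otimes>\<^sub>M distr M (P J) Z) E"
    unfolding joint by (simp add: emeasure_distr)
  also have "\<dots> = (\<integral>\<^sup>+w. emeasure (distr M (P J) Z) (Pair w -` E) \<partial>distr M (P {r}) W)"
    by (rule Z.emeasure_pair_measure_alt) simp
  also have "\<dots> = (\<integral>\<^sup>+w. F (w r) \<partial>distr M (P {r}) W)"
  proof (rule nn_integral_cong)
    fix w assume "w \<in> space (distr M (P {r}) W)"
    then have "Z -` (Pair w -` E) \<inter> space M = {\<omega> \<in> space M. \<forall>k\<in>J. X k \<omega> \<le> w r}"
      by (auto simp: E_def space_pair_measure) (auto simp: Z_def)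
    then show "emeasure (distr M (P J) Z) (Pair w -` E) = F (w r)"
      unfolding F_def by (simp add: emeasure_distr sets_Pair1)
  qed
  \<comment> \<open>Pulling back to \<open>M\<close> and pushing forward again exchanges the law of
    \<open>W\<close> for the law of \<open>X r\<close> on the real line.\<close>
  also have "\<dots> = (\<integral>\<^sup>+\<omega>. F (W \<omega> r) \<partial>M)"
  proof -
    have "(\<lambda>w. F (w r)) \<in> borel_measurable (P {r})"
      unfolding P_def by measurable
    then show ?thesis by (intro nn_integral_distr) simp_all
  qed
  also have "\<dots> = (\<integral>\<^sup>+t. F t \<partial>distr M borel (X r))"
    by (simp add: nn_integral_distr W_def)
  finally show ?thesis by (simp add: J_def F_def)
qed

section \<open>Convergence and measurability of the infinite products\<close>

lemma convergent_prod_omit: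
  assumes "summable (\<lambda>n. \<bar>f (Suc n) - 1\<bar>)"
  shows "convergent_prod (omit r f)"
proof -
  have "summable (\<lambda>n. norm (omit r f n - 1))"
    by (rule summable_comparison_test'[OF assms, of 0]) (auto simp: omit_def)
  then show ?thesis
    by (intro abs_convergent_prod_imp_convergent_prod summable_imp_abs_convergent_prod)
qed

lemma summable_power_Suc:
  fixes u :: real
  assumes "0 < u" "u < 1"
  shows "summable (\<lambda>n. \<bar>(1 - u ^ Suc n) - 1\<bar>)"
  using assms by (simp add: summable_mult summable_geometric abs_mult)

lemma convergent_prod_omit_power:
  fixes u :: real
  assumes "0 < u" "u < 1"
  shows "convergent_prod (omit r (\<lambda>k. 1 - u ^ k))"
  using summable_power_Suc[OF assms] by (rule convergent_prod_omit)

lemma convergent_prod_power_Suc: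
  fixes u :: real
  assumes "0 < u" "u < 1"
  shows "convergent_prod (\<lambda>n. 1 - u ^ Suc n)"
proof -
  \<comment> \<open>No \<open>Suc n\<close> equals 0, so omitting index 0 leaves the full
    product.\<close>
  have "convergent_prod (omit 0 (\<lambda>k. 1 - u ^ k))"
    using assms by (rule convergent_prod_omit_power)
  then show ?thesis by (simp add: omit_def[abs_def])
qed

text \<open>Multiplying termwise by a sequence with a single nontrivial factor restores Euler's
  product; since \<open>u ^ r < 1\<close>, that factor can be divided out.\<close>

lemma prodinf_omit_power:
  fixes u :: real
  assumes u: "0 < u" "u < 1" and r: "r \<ge> 1"
  shows "prodinf (omit r (\<lambda>k. 1 - u ^ k)) = euler_product u / (1 - u ^ r)"
proof -
  \<comment> \<open>The factor of index \<open>r\<close> sits at position \<open>r - 1\<close>,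
    exactly where \<open>omit\<close> has put a 1.\<close>
  define g where "g = (\<lambda>n. if n = r - 1 then 1 - u ^ r else 1)"
  have g: "g has_prod (1 - u ^ r)"
    unfolding g_def using has_prod_single[of "r - 1" "\<lambda>_. 1 - u ^ r"] by simp
  have "prodinf (omit r (\<lambda>k. 1 - u ^ k)) * prodinf g =
      (\<Prod>n. omit r (\<lambda>k. 1 - u ^ k) n * g n)"
    using g by (intro prodinf_mult convergent_prod_omit_power u) (auto simp: has_prod_iff)
  also have "(\<lambda>n. omit r (\<lambda>k. 1 - u ^ k) n * g n) = (\<lambda>n. 1 - u ^ Suc n)"
    using r by (auto simp: omit_def g_def fun_eq_iff)
  also have "prodinf g = 1 - u ^ r"
    using g by (simp add: has_prod_iff)
  finally show ?thesis
    using u r power_Suc_less_one[of u "r - 1"] by (simp add: euler_product_def field_simps)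
qed

text \<open>On the unit interval the function is the pointwise limit of polynomials, the partial
  products. The indicator extends this convergence trivially to all real \<open>u\<close>, including
  those where the infinite product may fail to converge.\<close>

lemma borel_measurable_prodinf_omit_power:
  "(\<lambda>u. indicator {0<..<1} u * prodinf (omit r (\<lambda>k. 1 - u ^ k)) :: real) \<in> borel_measurable borel"
proof (rule borel_measurable_LIMSEQ_real)
  fix u :: real
  show "(\<lambda>n. indicator {0<..<1} u * (\<Prod>i\<le>n. omit r (\<lambda>k. 1 - u ^ k) i))
      \<longlonglongrightarrow> indicator {0<..<1} u * prodinf (omit r (\<lambda>k. 1 - u ^ k))"
    using convergent_prod_LIMSEQ[OF convergent_prod_omit_power, of u r]
    by (auto simp: indicator_def)
next
  show "(\<lambda>u. indicator {0<..<1} u * (\<Prod>i\<le>n. omit r (\<lambda>k. 1 - u ^ k) i) :: real) \<in> borel_measurable borel" for n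
    unfolding omit_def by measurable
qed

section \<open>The distribution function of the supremum of the other variables\<close>

lemma (in prob_space) prob_all_others_le:
  assumes indep: "indep_vars (\<lambda>_. borel) Y {1..}"
    and exp: "\<And>k. k \<ge> 1 \<Longrightarrow> distributed M lborel (Y k) (exponential_density (real k))"
    and t: "t > 0"
  shows "prob {\<omega> \<in> space M. \<forall>k\<in>{1..} - {r}. Y k \<omega> \<le> t} =
    prodinf (omit r (\<lambda>k. 1 - exp (- t) ^ k))"
proof -
  \<comment> \<open>The bound \<open>Suc n\<close> keeps the index set nonempty, as the product rule
    for independence requires, and matches the partial product over
    \<open>i \<le> n\<close>.\<close>
  define A where "A = (\<lambda>n. {\<omega> \<in> space M. \<forall>k\<in>{1..Suc n}. k \<noteq> r \<longrightarrow> Y k \<omega> \<le> t})"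
  have Y[measurable]: "Y k \<in> borel_measurable M" if "k \<ge> 1" for k
    using exp[OF that] by (simp add: distributed_def)
  have A: "A n \<in> events" for n
    unfolding A_def by (rule sets.sets_Collect_finite_All) auto
  have prob_A: "prob (A n) = (\<Prod>i\<le>n. omit r (\<lambda>k. 1 - exp (- t) ^ k) i)" for n
  proof -
    \<comment> \<open>Index \<open>r\<close> is kept with no constraint: its event has probability
      1, which is the factor that \<open>omit\<close> inserts. No case split on whether
      \<open>r\<close> is at most \<open>Suc n\<close> is then needed.\<close>
    define B where "B = (\<lambda>k. if k = r then UNIV else {..t})"
    have "A n = (\<Inter>k\<in>{1..Suc n}. Y k -` B k \<inter> space M)"
      by (auto simp: A_def B_def)
    also have "prob \<dots> = (\<Prod>k\<in>{1..Suc n}. prob (Y k -` B k \<inter> space M))"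
      by (rule indep_varsD[OF indep]) (auto simp: B_def)
    also have "\<dots> = (\<Prod>k\<in>{1..Suc n}. if k = r then 1 else 1 - exp (- t) ^ k)"
    proof (rule prod.cong[OF refl])
      fix k assume k: "k \<in> {1..Suc n}"
      have "prob {\<omega> \<in> space M. Y k \<omega> \<le> t} = 1 - exp (- t) ^ k"
        using exponential_distributedD_le[OF exp, of k t] k t
        by (simp add: exp_of_nat_mult[symmetric] mult.commute)
      moreover have "Y k -` {..t} \<inter> space M = {\<omega> \<in> space M. Y k \<omega> \<le> t}" by auto
      ultimately show "prob (Y k -` B k \<inter> space M) = (if k = r then 1 else 1 - exp (- t) ^ k)"
        by (simp add: B_def prob_space)
    qed
    also have "\<dots> = (\<Prod>i\<le>n. omit r (\<lambda>k. 1 - exp (- t) ^ k) i)"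
      unfolding omit_def
      by (rule prod.reindex_bij_witness[of _ Suc "\<lambda>k. k - 1"]) auto
    finally show ?thesis .
  qed
  \<comment> \<open>The events \<open>A n\<close> decrease, so this is continuity from
    above.\<close>
  have "(\<lambda>n. prob (A n)) \<longlonglongrightarrow> prob (\<Inter>n. A n)"
    by (rule finite_Lim_measure_decseq) (use A in \<open>auto simp: A_def decseq_def\<close>)
  then have lim: "(\<lambda>n. \<Prod>i\<le>n. omit r (\<lambda>k. 1 - exp (- t) ^ k) i) \<longlonglongrightarrow> prob (\<Inter>n. A n)"
    unfolding prob_A .
  have INT_A: "(\<Inter>n. A n) = {\<omega> \<in> space M. \<forall>k\<in>{1..} - {r}. Y k \<omega> \<le> t}"
  proof (intro equalityI subsetI)
    fix \<omega> assume "\<omega> \<in> (\<Inter>n. A n)"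
    then have *: "\<omega> \<in> A n" for n by blast
    have "Y k \<omega> \<le> t" if "k \<in> {1..} - {r}" for k
      using *[of k] that by (simp add: A_def)
    then show "\<omega> \<in> {\<omega> \<in> space M. \<forall>k\<in>{1..} - {r}. Y k \<omega> \<le> t}"
      using *[of 0] by (simp add: A_def)
  qed (simp add: A_def)
  \<comment> \<open>Since \<open>t > 0\<close>, \<open>exp (- t)\<close> lies strictly between 0 and
    1 and the same partial products tend to the infinite product; uniqueness of limits
    concludes.\<close>
  have "(\<lambda>n. \<Prod>i\<le>n. omit r (\<lambda>k. 1 - exp (- t) ^ k) i)
      \<longlonglongrightarrow> prodinf (omit r (\<lambda>k. 1 - exp (- t) ^ k))"
    using t by (intro convergent_prod_LIMSEQ convergent_prod_omit_power) auto
  with lim[unfolded INT_A] show ?thesis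
    by (rule LIMSEQ_unique)
qed

section \<open>The substitution u = exp(-t)\<close>

lemma exp_minus_image_positive: "(\<lambda>t::real. exp (- t)) ` {0<..} = {0<..<1}"
proof safe
  fix u :: real assume "u \<in> {0<..<1}"
  then show "u \<in> (\<lambda>t. exp (- t)) ` {0<..}"
    by (intro image_eqI[of _ _ "- ln u"]) auto
qed auto

text \<open>The map is injective with Jacobian \<open>exp (- t)\<close> in absolute value, so the
  change of variables theorem carries both integrability and the value over to \<open>u\<close>.
  That theorem concerns Lebesgue measure, the completion of \<open>lborel\<close>; Borel
  measurability of \<open>f\<close> permits the return to \<open>lborel\<close>.\<close>

lemma lborel_substitution_exp_minus:
  fixes f :: "real \<Rightarrow> real"
  assumes f: "set_borel_measurable borel {0<..<1} f"
    and int: "set_integrable lborel {0<..} (\<lambda>t. exp (- t) * f (exp (- t)))"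
  shows "set_integrable lborel {0<..<1} f"
    and "(LINT t:{0<..}|lborel. exp (- t) * f (exp (- t))) = (LINT u:{0<..<1}|lborel. f u)"
proof -
  let ?g = "\<lambda>t. exp (- t) * f (exp (- t))"
  have deriv: "((\<lambda>t. exp (- t)) has_real_derivative - exp (- t)) (at t within {0<..})" for t :: real
    by (auto intro!: derivative_eq_intros)
  have "?g absolutely_integrable_on {0<..}"
    using int unfolding set_integrable_def
    by (subst integrable_completion) (auto dest: borel_measurable_integrable)
  then have ac: "f absolutely_integrable_on {0<..<1} \<and>
      integral {0<..<1} f = integral {0<..} ?g"
    using has_absolute_integral_change_of_variables_1'[of "{0<..}" "\<lambda>t. exp (- t)"
        "\<lambda>t. - exp (- t)" f "integral {0<..} ?g"]
    by (simp add: exp_minus_image_positive inj_on_def deriv)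
  then show int': "set_integrable lborel {0<..<1} f"
    using f unfolding set_integrable_def set_borel_measurable_def
    by (subst (asm) integrable_completion) auto
  show "(LINT t:{0<..}|lborel. ?g t) = (LINT u:{0<..<1}|lborel. f u)"
    using ac set_borel_integral_eq_integral(2)[OF int] set_borel_integral_eq_integral(2)[OF int']
    by simp
qed

section \<open>The integral formulas for the probability\<close>

theorem mainTheorem5:
  fixes M :: "'a measure" and Y :: "nat \<Rightarrow> 'a \<Rightarrow> real" and r :: nat
  assumes "prob_space M"
    and "prob_space.indep_vars M (\<lambda>_. borel) Y {1..}"
    and "\<And>k. k \<ge> 1 \<Longrightarrow> distributed M lborel (Y k) (exponential_density (real k))"
    and "r \<ge> 1"
  shows
    "(\<forall>t::real. t > 0 \<longrightarrow> convergent_prod (omit r (\<lambda>k. 1 - exp (- real k * t)))) \<and>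
     (\<forall>u::real. 0 < u \<and> u < 1 \<longrightarrow> convergent_prod (omit r (\<lambda>k. 1 - u ^ k))) \<and>
     (\<forall>u::real. 0 < u \<and> u < 1 \<longrightarrow> convergent_prod (\<lambda>n. 1 - u ^ Suc n)) \<and>
     set_integrable lborel {0<..}
       (\<lambda>t. real r * exp (- real r * t) * prodinf (omit r (\<lambda>k. 1 - exp (- real k * t)))) \<and>
     set_integrable lborel {0<..<1}
       (\<lambda>u. real r * u ^ (r - 1) * prodinf (omit r (\<lambda>k. 1 - u ^ k))) \<and>
     set_integrable lborel {0<..<1}
       (\<lambda>u. real r * u ^ (r - 1) * (euler_product u / (1 - u ^ r))) \<and>
     prob_space.prob_is_max M Y r =
       (LINT t:{0<..}|lborel.
          real r * exp (- real r * t) * prodinf (omit r (\<lambda>k. 1 - exp (- real k * t)))) \<and>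
     (LINT t:{0<..}|lborel.
          real r * exp (- real r * t) * prodinf (omit r (\<lambda>k. 1 - exp (- real k * t)))) =
       (LINT u:{0<..<1}|lborel. real r * u ^ (r - 1) * prodinf (omit r (\<lambda>k. 1 - u ^ k))) \<and>
     (LINT u:{0<..<1}|lborel. real r * u ^ (r - 1) * prodinf (omit r (\<lambda>k. 1 - u ^ k))) =
       (LINT u:{0<..<1}|lborel. real r * u ^ (r - 1) * (euler_product u / (1 - u ^ r)))"
proof -
  interpret prob_space M by fact
  note indep = assms(2) and expd = assms(3) and r = assms(4)
  let ?Pt = "\<lambda>t. prodinf (omit r (\<lambda>k. 1 - exp (- real k * t)))"
  let ?P = "\<lambda>u. prodinf (omit r (\<lambda>k. 1 - u ^ k))"
  let ?f = "\<lambda>u::real. real r * u ^ (r - 1) * ?P u"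
  have exp_power: "exp (- real k * t) = exp (- t) ^ k" for k t
    by (simp add: exp_of_nat_mult[symmetric])
  \<comment> \<open>One of the \<open>r \<ge> 1\<close> factors \<open>exp (- t)\<close> is split
    off as the Jacobian of the substitution.\<close>
  have subst: "real r * exp (- real r * t) * ?Pt t = exp (- t) * ?f (exp (- t))" for t
    using r unfolding exp_power by (cases r) auto
  define h where "h = (\<lambda>u::real. indicator {0<..<1} u * ?P u)"
  have h[measurable]: "h \<in> borel_measurable borel"
    unfolding h_def by (rule borel_measurable_prodinf_omit_power)
  define g where "g = (\<lambda>t. indicator {0<..} t *\<^sub>R (exp (- t) * ?f (exp (- t))))"
  have g_h: "g t = indicator {0<..} t * (exp (- t) * (real r * exp (- t) ^ (r - 1) * h (exp (- t))))" for t
    by (auto simp: g_def h_def indicator_def)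
  have g[measurable]: "g \<in> borel_measurable borel"
    unfolding g_h[abs_def] by measurable
  have P_prob: "?P (exp (- t)) = prob {\<omega> \<in> space M. \<forall>k\<in>{1..} - {r}. Y k \<omega> \<le> t}" if "t > 0" for t
    using prob_all_others_le[OF indep expd that] by simp
  \<comment> \<open>For \<open>t > 0\<close> the infinite product is a probability, hence
    nonnegative; elsewhere \<open>g\<close> vanishes.\<close>
  have g_nonneg: "g t \<ge> 0" for t
    using P_prob[of t] by (auto simp: g_def indicator_def)
  have [measurable]: "Y k \<in> borel_measurable M" if "k \<ge> 1" for k
    using expd[OF that] by (simp add: distributed_def)
  have [measurable]:
    "(\<lambda>t. emeasure M {\<omega> \<in> space M. \<forall>k\<in>{1..} - {r}. Y k \<omega> \<le> t}) \<in> borel_measurable borel"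
    by (rule borel_measurable_emeasure_all_le) auto
  have "emeasure M {\<omega> \<in> space M. \<forall>k\<in>{1..}. Y k \<omega> \<le> Y r \<omega>} =
      (\<integral>\<^sup>+t. emeasure M {\<omega> \<in> space M. \<forall>k\<in>{1..} - {r}. Y k \<omega> \<le> t} \<partial>distr M borel (Y r))"
    using r by (intro emeasure_all_le_indep[OF indep]) auto
  \<comment> \<open>\<open>borel\<close> and \<open>lborel\<close> have the same measurable sets,
    and only these matter for the target of \<open>distr\<close>.\<close>
  also have "distr M borel (Y r) = distr M lborel (Y r)"
    by (rule distr_cong) auto
  also have "\<dots> = density lborel (exponential_density (real r))"
    using expd[OF r] by (simp add: distributed_def)
  also have "(\<integral>\<^sup>+t. emeasure M {\<omega> \<in> space M. \<forall>k\<in>{1..} - {r}. Y k \<omega> \<le> t} \<partial>\<dots>) =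
    (\<integral>\<^sup>+t. ennreal (exponential_density (real r) t) *
        emeasure M {\<omega> \<in> space M. \<forall>k\<in>{1..} - {r}. Y k \<omega> \<le> t} \<partial>lborel)"
    by (rule nn_integral_density) auto
  also have "\<dots> = (\<integral>\<^sup>+t. ennreal (g t) \<partial>lborel)"
  proof (rule nn_integral_cong_AE)
    \<comment> \<open>At 0 the exponential density equals \<open>r\<close> while \<open>g\<close> is
      0, so the integrands agree only off this null set.\<close>
    have "AE t in lborel. t \<noteq> (0::real)"
      by (rule AE_lborel_singleton)
    then show "AE t in lborel. ennreal (exponential_density (real r) t) *
        emeasure M {\<omega> \<in> space M. \<forall>k\<in>{1..} - {r}. Y k \<omega> \<le> t} = ennreal (g t)"
    proof eventually_elim
      case (elim t)
      show ?case
      proof (cases "t > 0")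
        case True
        have "exponential_density (real r) t = real r * exp (- real r * t)"
          using True by (simp add: exponential_density_def mult.commute)
        also have "\<dots> = exp (- t) * (real r * exp (- t) ^ (r - 1))"
          using r unfolding exp_power by (cases r) auto
        finally have "exponential_density (real r) t = \<dots>" .
        then show ?thesis
          using True P_prob[OF True] 
          by (simp add: g_def emeasure_eq_measure ennreal_mult[symmetric] mult_ac)
      next
        case False
        then show ?thesis using elim by (simp add: g_def exponential_density_def)
      qed
    qed
  qed
  finally have nn: "(\<integral>\<^sup>+t. ennreal (g t) \<partial>lborel) = ennreal (prob_is_max Y r)"
    by (simp add: prob_is_max_def emeasure_eq_measure Ball_def)
  \<comment> \<open>The nonnegative integral of \<open>g\<close> is a probability, hence finite,
    which yields integrability without estimating the product.\<close>
  have int_g: "integrable lborel g"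
    using nn g_nonneg by (intro integrableI_nonneg) auto
  have max: "prob_is_max Y r = integral\<^sup>L lborel g"
    using nn g_nonneg by (subst integral_eq_nn_integral) (auto simp: prob_is_max_def)
  have sint: "set_integrable lborel {0<..} (\<lambda>t. exp (- t) * ?f (exp (- t)))"
    using int_g by (simp add: set_integrable_def g_def)
  have "(\<lambda>u. indicator {0<..<1} u *\<^sub>R ?f u) = (\<lambda>u. real r * u ^ (r - 1) * h u)"
    by (auto simp: h_def)
  then have f: "set_borel_measurable borel {0<..<1} ?f"
    unfolding set_borel_measurable_def by simp
  note cov = lborel_substitution_exp_minus[OF f sint]
  have euler: "?f u = real r * u ^ (r - 1) * (euler_product u / (1 - u ^ r))"
    if "u \<in> {0<..<1}" for u
    using that r by (simp add: prodinf_omit_power)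
  have int_euler: "set_integrable lborel {0<..<1} (\<lambda>u. real r * u ^ (r - 1) * (euler_product u / (1 - u ^ r)))"
    by (rule iffD1[OF set_integrable_cong[OF refl refl euler] cov(1)])
  have eq_euler: "(LINT u:{0<..<1}|lborel. ?f u) =
      (LINT u:{0<..<1}|lborel. real r * u ^ (r - 1) * (euler_product u / (1 - u ^ r)))"
    using euler by (intro set_lebesgue_integral_cong) auto
  have prob: "prob_is_max Y r = (LINT t:{0<..}|lborel. exp (- t) * ?f (exp (- t)))"
    unfolding max by (simp add: set_lebesgue_integral_def g_def)
  have conv: "\<forall>t::real. t > 0 \<longrightarrow> convergent_prod (omit r (\<lambda>k. 1 - exp (- real k * t)))"
    unfolding exp_power by (auto intro!: convergent_prod_omit_power)
  have "\<forall>u::real. 0 < u \<and> u < 1 \<longrightarrow> convergent_prod (omit r (\<lambda>k. 1 - u ^ k))"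
    and "\<forall>u::real. 0 < u \<and> u < 1 \<longrightarrow> convergent_prod (\<lambda>n. 1 - u ^ Suc n)"
    using convergent_prod_omit_power convergent_prod_power_Suc by blast+
  with conv show ?thesis
    unfolding subst
    by (intro conjI sint cov int_euler prob eq_euler)
qed

end
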